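(* Let $q\colon X\to Q$ be an open map of locales, and let $R:=X\times_Q X\rightarrowtail X\times X$ be its kernel pair, which is a localic relation on $X$ with open cones. Then $R$ is a fixed point, i.e. $R\cong R_{\Uparrow_R,\Downarrow_R}$ as sublocales of $X\times X$.
   Context: Frames and locales. A frame is a complete lattice (order $\sqsubseteq$) in which $x\wedge\bigvee y_i=\bigvee (x\wedge y_i)$; frame maps preserve finite meets and all joins. The category of locales is the opposite of the category of frames: a locale $X$ has a frame of opens $\mathcal{O}X$, and a map $f\colon X\to Y$ is a frame map $f^{-1}\colon\mathcal{O}Y\to\mathcal{O}X$. $L\otimes M$ is the coproduct of frames, generated under joins by the rectangles $x\otimes y=\iota_1(x)\wedge\iota_2(y)$ ($\iota_1,\iota_2$ the coproduct injections); $\mathcal{O}(X\times Y)=\mathcal{O}X\otimes\mathcal{O}Y$. A sublocale of $X$ is (an isomorphism class of) an extremal monomorphism $A\rightarrowtail X$, equivalently a map whose frame map is surjective. Open cone relations. A localic relation on $X$ is a sublocale $r\colon R\rightarrowtail X\times X$; its source and target maps are $s=\mathrm{pr}_1\circ r$, $t=\mathrm{pr}_2\circ r\colon R\to X$. A locale map $f\colon X\to Y$ is open if $f^{-1}$ has a left adjoint $f_!$ with $f_!(U\wedge f^{-1}(V))=f_!(U)\wedge V$. $R$ has open cones if $s,t$ are open; then its induced cones are $\Uparrow_R:=t_!s^{-1}$ and $\Downarrow_R:=s_!t^{-1}\colon\mathcal{O}X\to\mathcal{O}X$. These preserve all joins and are parallel in the sense below. The kernel pair of a locale map $q\colon X\to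 Q$ is the pullback $X\times_QX$ of $q$ along itself, a sublocale of $X\times X$ (the equaliser of $q\circ\mathrm{pr}_1$ and $q\circ\mathrm{pr}_2$); since open maps are stable under pullback, it has open cones when $q$ is open. Parallel pairs and induced relation. Functions $\mathsf{u},\mathsf{d}\colon L\to L$ on a frame are parallel if $\mathsf{u}(x)\wedge y\sqsubseteq\mathsf{u}(x\wedge\mathsf{d}(y))$ and $x\wedge\mathsf{d}(y)\sqsubseteq\mathsf{d}(\mathsf{u}(x)\wedge y)$ for all $x,y\in L$. Given such a join-preserving pair on $\mathcal{O}X$, let $\sim$ be the binary relation on rectangles of $\mathcal{O}X\otimes\mathcal{O}X$ with $a\otimes b\sim c\otimes d$ iff $\mathsf{u}(a)\wedge b=\mathsf{u}(c)\wedge d$ and $a\wedge\mathsf{d}(b)=c\wedge\mathsf{d}(d)$. An element $o\in\mathcal{O}X\otimes\mathcal{O}X$ is $\sim$-saturated if for all $p\sim q$ and all $w$: $p\wedge w\sqsubseteq o$ iff $q\wedge w\sqsubseteq o$. $R_{\mathsf{u},\mathsf{d}}\rightarrowtail X\times X$ is the sublocale whose frame is the set of $\sim$-saturated elements, with frame map $\mu_\sim(o)=$ the least $\sim$-saturated element above $o$; equivalently, the quotient of $\mathcal{O}X\otimes\mathcal{O}X$ by the frame congruence generated by $\sim$. *)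

theory Defs
  imports Main
begin

section \<open>Frames and locale maps\<close>

text \<open>The class \<open>complete_distrib_lattice\<close> of Main is complete distributivity, which is too strong.\<close>

class frame = complete_lattice +
  assumes inf_Sup_frame: "inf x (Sup A) = (SUP y\<in>A. inf x y)"

text \<open>A locale is a type of class \<open>frame\<close> (its frame of opens). A locale map from \<open>X\<close> to \<open>Y\<close>
  is represented by its frame map \<open>'y \<Rightarrow> 'x\<close>, in the opposite direction.\<close>

definition frame_hom :: "('a::frame \<Rightarrow> 'b::frame) \<Rightarrow> bool" where
  "frame_hom f \<longleftrightarrow> f top = top \<and> (\<forall>x y. f (inf x y) = inf (f x) (f y)) \<and>
     (\<forall>A. f (Sup A) = Sup (f ` A))"

definition left_adjoint_of :: "('b::order \<Rightarrow> 'a::order) \<Rightarrow> ('a \<Rightarrow> 'b) \<Rightarrow> bool" where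
  "left_adjoint_of g f \<longleftrightarrow> (\<forall>U V. g U \<le> V \<longleftrightarrow> U \<le> f V)"

text \<open>\<open>lower f\<close> is the direct image \<open>f\<^sub>!\<close>; it is meaningful when \<open>f\<close> has a left adjoint, which is
  then unique.\<close>

definition lower :: "('a::order \<Rightarrow> 'b::order) \<Rightarrow> 'b \<Rightarrow> 'a" where
  "lower f = (THE g. left_adjoint_of g f)"

definition open_map :: "('a::frame \<Rightarrow> 'b::frame) \<Rightarrow> bool" where
  "open_map f \<longleftrightarrow> frame_hom f \<and>
     (\<exists>g. left_adjoint_of g f \<and> (\<forall>U V. g (inf U (f V)) = inf (g U) V))"

lemma lower_eqI: "left_adjoint_of g f \<Longrightarrow> lower f = g"
  unfolding lower_def left_adjoint_of_def
  by (rule the_equality) (auto intro!: ext order.antisym)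

lemma frame_hom_comp: "frame_hom f \<Longrightarrow> frame_hom g \<Longrightarrow> frame_hom (f \<circ> g)"
  by (simp add: frame_hom_def image_comp)

lemma frame_hom_mono: "frame_hom f \<Longrightarrow> x \<le> y \<Longrightarrow> f x \<le> f y"
  unfolding frame_hom_def by (metis inf.absorb_iff1)

lemma frame_hom_bot: "frame_hom f \<Longrightarrow> f bot = bot"
  unfolding frame_hom_def by (metis Sup_empty image_empty)

lemma Sup_inf_frame: "inf (Sup A) x = (SUP y\<in>A. inf y (x::'a::frame))"
  by (simp add: inf_commute inf_Sup_frame)

section \<open>Coproduct of frames\<close>

text \<open>The coproduct is realised as the frame of C-ideals: down-sets of \<open>L \<times> M\<close> that are closed
  under joins (the empty one included) in each coordinate. The universal property is proved in
  \<open>tensor_universal\<close>.\<close>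

definition c_ideal :: "('a::frame \<times> 'b::frame) set \<Rightarrow> bool" where
  "c_ideal D \<longleftrightarrow>
     (\<forall>a b a' b'. (a, b) \<in> D \<and> a' \<le> a \<and> b' \<le> b \<longrightarrow> (a', b') \<in> D) \<and>
     (\<forall>A b. (\<forall>a\<in>A. (a, b) \<in> D) \<longrightarrow> (Sup A, b) \<in> D) \<and>
     (\<forall>a B. (\<forall>b\<in>B. (a, b) \<in> D) \<longrightarrow> (a, Sup B) \<in> D)"

lemma c_idealI:
  assumes "\<And>a b a' b'. (a, b) \<in> D \<Longrightarrow> a' \<le> a \<Longrightarrow> b' \<le> b \<Longrightarrow> (a', b') \<in> D"
    and "\<And>A b. (\<And>a. a \<in> A \<Longrightarrow> (a, b) \<in> D) \<Longrightarrow> (Sup A, b) \<in> D"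
    and "\<And>a B. (\<And>b. b \<in> B \<Longrightarrow> (a, b) \<in> D) \<Longrightarrow> (a, Sup B) \<in> D"
  shows "c_ideal D"
  unfolding c_ideal_def
proof (intro conjI allI impI)
  show "(a', b') \<in> D" if "(a, b) \<in> D \<and> a' \<le> a \<and> b' \<le> b" for a b a' b'
    using that assms(1)[of a b a' b'] by simp
  show "(Sup A, b) \<in> D" if "\<forall>a\<in>A. (a, b) \<in> D" for A b
    using that by (intro assms(2)) simp
  show "(a, Sup B) \<in> D" if "\<forall>b\<in>B. (a, b) \<in> D" for a B
    using that by (intro assms(3)) simp
qed

lemma c_ideal_down: "c_ideal D \<Longrightarrow> (a, b) \<in> D \<Longrightarrow> a' \<le> a \<Longrightarrow> b' \<le> b \<Longrightarrow> (a', b') \<in> D"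
  unfolding c_ideal_def by (drule conjunct1) blast

lemma c_ideal_Sup1:
  assumes "c_ideal D" and "\<And>a. a \<in> A \<Longrightarrow> (a, b) \<in> D"
  shows "(Sup A, b) \<in> D"
  using assms(1)[unfolded c_ideal_def, THEN conjunct2, THEN conjunct1] assms(2) by simp

lemma c_ideal_Sup2:
  assumes "c_ideal D" and "\<And>b. b \<in> B \<Longrightarrow> (a, b) \<in> D"
  shows "(a, Sup B) \<in> D"
  using assms(1)[unfolded c_ideal_def, THEN conjunct2, THEN conjunct2] assms(2) by simp

lemma c_ideal_UNIV: "c_ideal UNIV"
  by (simp add: c_ideal_def)

lemma c_ideal_Inter:
  assumes "\<And>D. D \<in> \<D> \<Longrightarrow> c_ideal D"
  shows "c_ideal (\<Inter>\<D>)"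
proof (rule c_idealI; rule InterI)
  show "(a', b') \<in> D" if "(a, b) \<in> \<Inter>\<D>" "a' \<le> a" "b' \<le> b" "D \<in> \<D>" for a b a' b' D
    using c_ideal_down[OF assms[OF that(4)], of a b] that by blast
  show "(Sup A, b) \<in> D" if "\<And>a. a \<in> A \<Longrightarrow> (a, b) \<in> \<Inter>\<D>" "D \<in> \<D>" for A b D
    using that by (intro c_ideal_Sup1[OF assms]) auto
  show "(a, Sup B) \<in> D" if "\<And>b. b \<in> B \<Longrightarrow> (a, b) \<in> \<Inter>\<D>" "D \<in> \<D>" for a B D
    using that by (intro c_ideal_Sup2[OF assms]) auto
qed

lemma c_ideal_Int: "c_ideal D \<Longrightarrow> c_ideal E \<Longrightarrow> c_ideal (D \<inter> E)"
  using c_ideal_Inter[of "{D, E}"] by auto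

typedef (overloaded) ('a::frame, 'b::frame) tensor = "{D :: ('a \<times> 'b) set. c_ideal D}"
  morphisms rep_tensor abs_tensor
  using c_ideal_UNIV by blast

lemma c_ideal_rep: "c_ideal (rep_tensor D)"
  using rep_tensor by blast

instantiation tensor :: (frame, frame) complete_lattice
begin

definition less_eq_tensor :: "('a, 'b) tensor \<Rightarrow> ('a, 'b) tensor \<Rightarrow> bool" where
  "D \<le> E \<longleftrightarrow> rep_tensor D \<subseteq> rep_tensor E"
definition less_tensor :: "('a, 'b) tensor \<Rightarrow> ('a, 'b) tensor \<Rightarrow> bool" where
  "D < E \<longleftrightarrow> rep_tensor D \<subset> rep_tensor E"
definition inf_tensor :: "('a, 'b) tensor \<Rightarrow> ('a, 'b) tensor \<Rightarrow> ('a, 'b) tensor" where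
  "inf D E = abs_tensor (rep_tensor D \<inter> rep_tensor E)"
definition Inf_tensor :: "('a, 'b) tensor set \<Rightarrow> ('a, 'b) tensor" where
  "Inf \<D> = abs_tensor (\<Inter>(rep_tensor ` \<D>))"
definition sup_tensor :: "('a, 'b) tensor \<Rightarrow> ('a, 'b) tensor \<Rightarrow> ('a, 'b) tensor" where
  "sup_tensor D E = Inf {F. D \<le> F \<and> E \<le> F}"
definition Sup_tensor :: "('a, 'b) tensor set \<Rightarrow> ('a, 'b) tensor" where
  "Sup_tensor \<D> = Inf {F. \<forall>D\<in>\<D>. D \<le> F}"
definition top_tensor :: "('a, 'b) tensor" where
  "top = abs_tensor UNIV"
definition bot_tensor :: "('a, 'b) tensor" where
  "bot_tensor = Inf UNIV"

lemma rep_inf: "rep_tensor (inf D E) = rep_tensor D \<inter> rep_tensor E"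
  unfolding inf_tensor_def by (simp add: abs_tensor_inverse c_ideal_Int c_ideal_rep)

lemma rep_Inf: "rep_tensor (Inf \<D>) = \<Inter>(rep_tensor ` \<D>)"
proof -
  have "c_ideal (\<Inter>(rep_tensor ` \<D>))" by (rule c_ideal_Inter) (auto simp: c_ideal_rep)
  then show ?thesis unfolding Inf_tensor_def by (simp add: abs_tensor_inverse)
qed

lemma rep_top: "rep_tensor top = UNIV"
  unfolding top_tensor_def by (simp add: abs_tensor_inverse c_ideal_UNIV)

instance
proof
  fix x y z :: "('a, 'b) tensor" and A :: "('a, 'b) tensor set"
  show "(x < y) = (x \<le> y \<and> \<not> y \<le> x)" by (auto simp: less_eq_tensor_def less_tensor_def)
  show "x \<le> x" by (simp add: less_eq_tensor_def)
  show "x \<le> y \<Longrightarrow> y \<le> z \<Longrightarrow> x \<le> z" by (auto simp: less_eq_tensor_def)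
  show "x \<le> y \<Longrightarrow> y \<le> x \<Longrightarrow> x = y" by (auto simp: less_eq_tensor_def rep_tensor_inject)
  show "inf x y \<le> x" "inf x y \<le> y" by (auto simp: less_eq_tensor_def rep_inf)
  show "x \<le> y \<Longrightarrow> x \<le> z \<Longrightarrow> x \<le> inf y z" by (auto simp: less_eq_tensor_def rep_inf)
  show "x \<le> sup x y" "y \<le> sup x y" by (auto simp: less_eq_tensor_def sup_tensor_def rep_Inf)
  show "y \<le> x \<Longrightarrow> z \<le> x \<Longrightarrow> sup y z \<le> x"
    by (auto simp: less_eq_tensor_def sup_tensor_def rep_Inf)
  show "x \<in> A \<Longrightarrow> Inf A \<le> x" by (auto simp: less_eq_tensor_def rep_Inf)
  show "(\<And>x. x \<in> A \<Longrightarrow> z \<le> x) \<Longrightarrow> z \<le> Inf A" by (auto simp: less_eq_tensor_def rep_Inf)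
  show "x \<in> A \<Longrightarrow> x \<le> Sup A" by (auto simp: less_eq_tensor_def Sup_tensor_def rep_Inf)
  show "(\<And>x. x \<in> A \<Longrightarrow> x \<le> z) \<Longrightarrow> Sup A \<le> z"
    by (force simp: less_eq_tensor_def Sup_tensor_def rep_Inf)
  show "Inf {} = (top :: ('a, 'b) tensor)" by (simp add: Inf_tensor_def top_tensor_def)
  show "Sup {} = (bot :: ('a, 'b) tensor)" by (simp add: Sup_tensor_def bot_tensor_def)
qed

end

lemma c_ideal_imp:
  assumes I: "c_ideal I" and K: "c_ideal K"
  shows "c_ideal {(a, b). \<forall>x y. x \<le> a \<and> y \<le> b \<and> (x, y) \<in> I \<longrightarrow> (x, y) \<in> K}" (is "c_ideal ?H")
proof (rule c_idealI)
  show "(a', b') \<in> ?H" if "(a, b) \<in> ?H" "a' \<le> a" "b' \<le> b" for a b a' b'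
    using that by (auto dest: order_trans)
next
  fix A b assume A: "\<And>a. a \<in> A \<Longrightarrow> (a, b) \<in> ?H"
  have "(x, y) \<in> K" if x: "x \<le> Sup A" and y: "y \<le> b" and xy: "(x, y) \<in> I" for x y
  proof -
    have "(inf x a, y) \<in> K" if "a \<in> A" for a
    proof -
      have "(inf x a, y) \<in> I" by (rule c_ideal_down[OF I xy]) auto
      then show ?thesis using A[OF that] y by auto
    qed
    then have "(Sup (inf x ` A), y) \<in> K" by (intro c_ideal_Sup1[OF K]) auto
    also have "Sup (inf x ` A) = x" using x by (simp add: inf_Sup_frame[symmetric] inf.absorb1)
    finally show ?thesis .
  qed
  then show "(Sup A, b) \<in> ?H" by blast
next
  fix a B assume B: "\<And>b. b \<in> B \<Longrightarrow> (a, b) \<in> ?H"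
  have "(x, y) \<in> K" if x: "x \<le> a" and y: "y \<le> Sup B" and xy: "(x, y) \<in> I" for x y
  proof -
    have "(x, inf y b) \<in> K" if "b \<in> B" for b
    proof -
      have "(x, inf y b) \<in> I" by (rule c_ideal_down[OF I xy]) auto
      then show ?thesis using B[OF that] x by auto
    qed
    then have "(x, Sup (inf y ` B)) \<in> K" by (intro c_ideal_Sup2[OF K]) auto
    also have "Sup (inf y ` B) = y" using y by (simp add: inf_Sup_frame[symmetric] inf.absorb1)
    finally show ?thesis .
  qed
  then show "(a, Sup B) \<in> ?H" by blast
qed

instance tensor :: (frame, frame) frame
proof
  fix D :: "('a, 'b) tensor" and \<E> :: "('a, 'b) tensor set"
  let ?K = "SUP E\<in>\<E>. inf D E"
  let ?H = "{(a, b). \<forall>x y. x \<le> a \<and> y \<le> b \<and> (x, y) \<in> rep_tensor D \<longrightarrow> (x, y) \<in> rep_tensor ?K}"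
  have rep: "rep_tensor (abs_tensor ?H) = ?H"
    by (simp add: abs_tensor_inverse c_ideal_imp c_ideal_rep)
  have "E \<le> abs_tensor ?H" if E: "E \<in> \<E>" for E
  proof -
    have "inf D E \<le> ?K" using E by (rule SUP_upper)
    then have "rep_tensor D \<inter> rep_tensor E \<subseteq> rep_tensor ?K"
      by (simp add: less_eq_tensor_def rep_inf)
    then show ?thesis
      unfolding less_eq_tensor_def rep using c_ideal_down[OF c_ideal_rep[of E]] by blast
  qed
  then have "Sup \<E> \<le> abs_tensor ?H" by (rule Sup_least)
  then have "inf D (Sup \<E>) \<le> ?K"
    unfolding less_eq_tensor_def rep rep_inf by blast
  moreover have "?K \<le> inf D (Sup \<E>)"
    by (rule SUP_least) (auto intro: le_infI2 Sup_upper)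
  ultimately show "inf D (Sup \<E>) = ?K" by (rule order.antisym)
qed

definition iota1 :: "'a::frame \<Rightarrow> ('a, 'b::frame) tensor" where
  "iota1 a = abs_tensor {(x, y). x \<le> a \<or> y = bot}"

definition iota2 :: "'b::frame \<Rightarrow> ('a::frame, 'b) tensor" where
  "iota2 b = abs_tensor {(x, y). x = bot \<or> y \<le> b}"

definition rect :: "'a::frame \<Rightarrow> 'b::frame \<Rightarrow> ('a, 'b) tensor" where
  "rect a b = inf (iota1 a) (iota2 b)"

lemma rep_iota1: "rep_tensor (iota1 a) = {(x, y). x \<le> a \<or> y = bot}" (is "_ = ?D")
proof -
  have "c_ideal ?D"
    by (rule c_idealI) (auto simp: bot_unique intro: order_trans Sup_least)
  then show ?thesis by (simp add: iota1_def abs_tensor_inverse)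
qed

lemma rep_iota2: "rep_tensor (iota2 b) = {(x, y). x = bot \<or> y \<le> b}" (is "_ = ?D")
proof -
  have "c_ideal ?D"
    by (rule c_idealI) (auto simp: bot_unique intro: order_trans Sup_least)
  then show ?thesis by (simp add: iota2_def abs_tensor_inverse)
qed

lemma rep_rect: "rep_tensor (rect a b) = {(x, y). x \<le> a \<and> y \<le> b \<or> x = bot \<or> y = bot}"
  by (auto simp: rect_def rep_inf rep_iota1 rep_iota2)

lemma c_ideal_bot1: "c_ideal D \<Longrightarrow> (bot, b) \<in> D"
  using c_ideal_Sup1[of D "{}" b] by simp

lemma c_ideal_bot2: "c_ideal D \<Longrightarrow> (a, bot) \<in> D"
  using c_ideal_Sup2[of D "{}" a] by simp

lemma rect_le_iff: "rect a b \<le> D \<longleftrightarrow> (a, b) \<in> rep_tensor D"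
  unfolding less_eq_tensor_def rep_rect
  using c_ideal_down[OF c_ideal_rep[of D], of a b] c_ideal_bot1[OF c_ideal_rep[of D]]
    c_ideal_bot2[OF c_ideal_rep[of D]]
  by auto

lemma tensor_eq_Sup_rect: "D = (SUP (a, b) \<in> rep_tensor D. rect a b)"
proof (rule order.antisym)
  show "D \<le> (SUP (a, b) \<in> rep_tensor D. rect a b)"
  proof (unfold less_eq_tensor_def, rule subrelI)
    fix a b assume "(a, b) \<in> rep_tensor D"
    then have "rect a b \<le> (SUP (a, b) \<in> rep_tensor D. rect a b)"
      by (rule SUP_upper2) simp
    then show "(a, b) \<in> rep_tensor (SUP (a, b) \<in> rep_tensor D. rect a b)"
      by (simp add: rect_le_iff)
  qed
  show "(SUP (a, b) \<in> rep_tensor D. rect a b) \<le> D"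
    by (rule SUP_least) (auto simp: rect_le_iff)
qed

lemma left_adjoint_Sup:
  fixes g :: "'b::complete_lattice \<Rightarrow> 'a::complete_lattice"
  assumes "\<And>U V. g U \<le> V \<longleftrightarrow> U \<le> f V"
  shows "g (Sup A) = Sup (g ` A)"
proof (rule order.antisym)
  show "g (Sup A) \<le> Sup (g ` A)"
    unfolding assms by (rule Sup_least) (simp add: assms[symmetric] Sup_upper)
  show "Sup (g ` A) \<le> g (Sup A)"
  proof (rule SUP_least)
    fix x assume "x \<in> A"
    moreover have "Sup A \<le> f (g (Sup A))" using assms by blast
    ultimately show "g x \<le> g (Sup A)" unfolding assms by (meson Sup_upper order_trans)
  qed
qed

lemma frame_hom_iota1: "frame_hom (iota1 :: 'a::frame \<Rightarrow> ('a, 'b::frame) tensor)"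
  unfolding frame_hom_def
proof (intro conjI allI)
  show "(iota1 top :: ('a, 'b) tensor) = top"
    by (simp add: rep_tensor_inject[symmetric] rep_iota1 rep_top)
  show "(iota1 (inf x y) :: ('a, 'b) tensor) = inf (iota1 x) (iota1 y)" for x y
    by (auto simp: rep_tensor_inject[symmetric] rep_iota1 rep_inf)
  show "(iota1 (Sup A) :: ('a, 'b) tensor) = Sup (iota1 ` A)" for A
  proof (rule left_adjoint_Sup)
    fix U :: 'a and V :: "('a, 'b) tensor"
    let ?f = "\<lambda>V::('a, 'b) tensor. Sup {a. (a, top) \<in> rep_tensor V}"
    have "(?f V, top) \<in> rep_tensor V" by (rule c_ideal_Sup1[OF c_ideal_rep]) simp
    then have "U \<le> ?f V \<longleftrightarrow> (U, top) \<in> rep_tensor V"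
      using c_ideal_down[OF c_ideal_rep[of V], of "?f V" top U top] by (blast intro: Sup_upper)
    also have "\<dots> \<longleftrightarrow> iota1 U \<le> V"
      unfolding less_eq_tensor_def rep_iota1
      using c_ideal_down[OF c_ideal_rep[of V], of U top] c_ideal_bot2[OF c_ideal_rep[of V]]
      by auto
    finally show "iota1 U \<le> V \<longleftrightarrow> U \<le> ?f V" by simp
  qed
qed

lemma frame_hom_iota2: "frame_hom (iota2 :: 'b::frame \<Rightarrow> ('a::frame, 'b) tensor)"
  unfolding frame_hom_def
proof (intro conjI allI)
  show "(iota2 top :: ('a, 'b) tensor) = top"
    by (simp add: rep_tensor_inject[symmetric] rep_iota2 rep_top)
  show "(iota2 (inf x y) :: ('a, 'b) tensor) = inf (iota2 x) (iota2 y)" for x y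
    by (auto simp: rep_tensor_inject[symmetric] rep_iota2 rep_inf)
  show "(iota2 (Sup A) :: ('a, 'b) tensor) = Sup (iota2 ` A)" for A
  proof (rule left_adjoint_Sup)
    fix U :: 'b and V :: "('a, 'b) tensor"
    let ?f = "\<lambda>V::('a, 'b) tensor. Sup {b. (top, b) \<in> rep_tensor V}"
    have "(top, ?f V) \<in> rep_tensor V" by (rule c_ideal_Sup2[OF c_ideal_rep]) simp
    then have "U \<le> ?f V \<longleftrightarrow> (top, U) \<in> rep_tensor V"
      using c_ideal_down[OF c_ideal_rep[of V], of top "?f V" top U] by (blast intro: Sup_upper)
    also have "\<dots> \<longleftrightarrow> iota2 U \<le> V"
      unfolding less_eq_tensor_def rep_iota2
      using c_ideal_down[OF c_ideal_rep[of V], of top U] c_ideal_bot1[OF c_ideal_rep[of V]]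
      by auto
    finally show "iota2 U \<le> V \<longleftrightarrow> U \<le> ?f V" by simp
  qed
qed

theorem tensor_universal:
  fixes f :: "'a::frame \<Rightarrow> 'c::frame" and g :: "'b::frame \<Rightarrow> 'c"
  assumes f: "frame_hom f" and g: "frame_hom g"
  shows "\<exists>!h :: ('a, 'b) tensor \<Rightarrow> 'c. frame_hom h \<and> h \<circ> iota1 = f \<and> h \<circ> iota2 = g"
proof (rule ex_ex1I)
  define h where "h D = (SUP (a, b) \<in> rep_tensor D. inf (f a) (g b))" for D :: "('a, 'b) tensor"
  have f_inf: "f (inf x y) = inf (f x) (f y)" and f_Sup: "f (Sup A) = Sup (f ` A)" for x y A
    using f by (auto simp: frame_hom_def)
  have g_inf: "g (inf x y) = inf (g x) (g y)" and g_Sup: "g (Sup B) = Sup (g ` B)" for x y B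
    using g by (auto simp: frame_hom_def)
  have tops: "f top = top" "g top = top" using f g by (auto simp: frame_hom_def)
  have upper: "inf (f a) (g b) \<le> h D" if "(a, b) \<in> rep_tensor D" for a b D
    unfolding h_def by (rule SUP_upper2[OF that]) simp
  have h_Sup: "h (Sup A) = Sup (h ` A)" for A
  proof (rule left_adjoint_Sup)
    fix U :: "('a, 'b) tensor" and V :: 'c
    let ?G = "{(a, b). inf (f a) (g b) \<le> V}"
    have "c_ideal ?G"
    proof (rule c_idealI)
      show "(a', b') \<in> ?G" if "(a, b) \<in> ?G" "a' \<le> a" "b' \<le> b" for a b a' b'
        using that order_trans[OF inf_mono[OF frame_hom_mono[OF f] frame_hom_mono[OF g]]]
        by simp
      show "(Sup A, b) \<in> ?G" if "\<And>a. a \<in> A \<Longrightarrow> (a, b) \<in> ?G" for A b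
        using that by (auto simp: f_Sup Sup_inf_frame image_image intro!: SUP_least)
      show "(a, Sup B) \<in> ?G" if "\<And>b. b \<in> B \<Longrightarrow> (a, b) \<in> ?G" for a B
        using that by (auto simp: g_Sup inf_Sup_frame image_image intro!: SUP_least)
    qed
    then have "rep_tensor (abs_tensor ?G) = ?G" by (simp add: abs_tensor_inverse)
    then show "h U \<le> V \<longleftrightarrow> U \<le> abs_tensor ?G"
      unfolding h_def less_eq_tensor_def SUP_le_iff by auto
  qed
  have h_mono: "h D \<le> h E" if "D \<le> E" for D E
    using that unfolding h_def less_eq_tensor_def by (rule SUP_subset_mono) simp
  have h_inf: "h (inf D E) = inf (h D) (h E)" for D E
  proof (rule order.antisym)
    show "h (inf D E) \<le> inf (h D) (h E)" by (simp add: h_mono)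
    have "inf (inf (f a) (g b)) (inf (f a') (g b')) \<le> h (inf D E)"
      if ab: "(a, b) \<in> rep_tensor D" and ab': "(a', b') \<in> rep_tensor E" for a b a' b'
    proof -
      have "(inf a a', inf b b') \<in> rep_tensor (inf D E)"
        unfolding rep_inf
        using c_ideal_down[OF c_ideal_rep ab] c_ideal_down[OF c_ideal_rep ab'] by auto
      from upper[OF this] show ?thesis by (simp add: f_inf g_inf ac_simps)
    qed
    then have 1: "inf (inf (f a) (g b)) (h E) \<le> h (inf D E)" if "(a, b) \<in> rep_tensor D" for a b
      using that unfolding h_def[of E] inf_Sup_frame image_image by (auto intro!: SUP_least)
    show "inf (h D) (h E) \<le> h (inf D E)"
      using 1 unfolding h_def[of D] Sup_inf_frame image_image by (auto intro!: SUP_least)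
  qed
  have "h top = top"
    using upper[of top top top] by (simp add: rep_top tops top_unique)
  then have "frame_hom h" by (simp add: frame_hom_def h_inf h_Sup)
  moreover have "h (iota1 a) = f a" for a
  proof (rule order.antisym)
    show "h (iota1 a) \<le> f a"
      unfolding h_def rep_iota1
      by (rule SUP_least) (auto simp: frame_hom_bot[OF g] intro: le_infI1 frame_hom_mono[OF f])
    show "f a \<le> h (iota1 a)" using upper[of a top "iota1 a"] by (simp add: rep_iota1 tops)
  qed
  moreover have "h (iota2 b) = g b" for b
  proof (rule order.antisym)
    show "h (iota2 b) \<le> g b"
      unfolding h_def rep_iota2
      by (rule SUP_least) (auto simp: frame_hom_bot[OF f] intro: le_infI2 frame_hom_mono[OF g])
    show "g b \<le> h (iota2 b)" using upper[of top b "iota2 b"] by (simp add: rep_iota2 tops)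
  qed
  ultimately show "\<exists>h :: ('a, 'b) tensor \<Rightarrow> 'c. frame_hom h \<and> h \<circ> iota1 = f \<and> h \<circ> iota2 = g"
    by (auto simp: fun_eq_iff)
next
  fix h k :: "('a, 'b) tensor \<Rightarrow> 'c"
  assume h: "frame_hom h \<and> h \<circ> iota1 = f \<and> h \<circ> iota2 = g"
    and k: "frame_hom k \<and> k \<circ> iota1 = f \<and> k \<circ> iota2 = g"
  have "h (rect a b) = k (rect a b)" for a b
    using h k by (simp add: frame_hom_def rect_def fun_eq_iff)
  then have eq: "h ` (\<lambda>(a, b). rect a b) ` R = k ` (\<lambda>(a, b). rect a b) ` R" for R
    unfolding image_image by (intro image_cong) auto
  have "h D = k D" for D
  proof -
    have "h (Sup A) = Sup (h ` A)" "k (Sup A) = Sup (k ` A)" for A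
      using h k by (auto simp: frame_hom_def)
    then show ?thesis using eq[of "rep_tensor D"] tensor_eq_Sup_rect[of D] by metis
  qed
  then show "h = k" by blast
qed

section \<open>Sublocales, localic relations and kernel pairs\<close>

text \<open>A sublocale is represented by a surjective frame map \<open>r\<close>, so a localic relation on \<open>X\<close> is a
  surjective frame map out of \<open>('x, 'x) tensor\<close>.\<close>

definition is_sublocale :: "('a::frame \<Rightarrow> 'r::frame) \<Rightarrow> bool" where
  "is_sublocale r \<longleftrightarrow> frame_hom r \<and> surj r"

definition source :: "(('x::frame, 'x) tensor \<Rightarrow> 'r) \<Rightarrow> 'x \<Rightarrow> 'r" where
  "source r = r \<circ> iota1"

definition target :: "(('x::frame, 'x) tensor \<Rightarrow> 'r) \<Rightarrow> 'x \<Rightarrow> 'r" where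
  "target r = r \<circ> iota2"

definition has_open_cones :: "(('x::frame, 'x) tensor \<Rightarrow> 'r::frame) \<Rightarrow> bool" where
  "has_open_cones r \<longleftrightarrow> open_map (source r) \<and> open_map (target r)"

definition up_cone :: "(('x::frame, 'x) tensor \<Rightarrow> 'r::frame) \<Rightarrow> 'x \<Rightarrow> 'x" where
  "up_cone r = lower (target r) \<circ> source r"

definition down_cone :: "(('x::frame, 'x) tensor \<Rightarrow> 'r::frame) \<Rightarrow> 'x \<Rightarrow> 'x" where
  "down_cone r = lower (source r) \<circ> target r"

definition frame_congruence :: "('a::frame \<times> 'a) set \<Rightarrow> bool" where
  "frame_congruence E \<longleftrightarrow> equiv UNIV E \<and>
     (\<forall>a b c d. (a, b) \<in> E \<and> (c, d) \<in> E \<longrightarrow> (inf a c, inf b d) \<in> E) \<and>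
     (\<forall>P \<subseteq> E. (Sup (fst ` P), Sup (snd ` P)) \<in> E)"

definition generated_congruence :: "('a::frame \<times> 'a) set \<Rightarrow> ('a \<times> 'a) set" where
  "generated_congruence S = \<Inter>{E. frame_congruence E \<and> S \<subseteq> E}"

text \<open>The equaliser of two locale maps \<open>f, g\<close> from \<open>X\<close> to \<open>Y\<close> is dually the coequaliser of the
  frame maps, the quotient by the frame congruence generated by the pairs \<open>(f V, g V)\<close>. As HOL
  cannot quantify over all test locales inside a definition, the universal properties are proved
  separately, in \<open>equaliser_universal\<close> and \<open>kernel_pair_universal\<close>.\<close>

definition is_equaliser :: "('x::frame \<Rightarrow> 'e::frame) \<Rightarrow> ('y::frame \<Rightarrow> 'x) \<Rightarrow> ('y \<Rightarrow> 'x) \<Rightarrow> bool" where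
  "is_equaliser e f g \<longleftrightarrow> is_sublocale e \<and>
     {(a, b). e a = e b} = generated_congruence (range (\<lambda>V. (f V, g V)))"

definition is_kernel_pair ::
    "('q::frame \<Rightarrow> 'x::frame) \<Rightarrow> (('x, 'x) tensor \<Rightarrow> 'r::frame) \<Rightarrow> bool" where
  "is_kernel_pair q r \<longleftrightarrow> is_equaliser r (iota1 \<circ> q) (iota2 \<circ> q)"

lemma frame_congruence_kernel:
  assumes "frame_hom k" shows "frame_congruence {(a, b). k a = k b}"
proof -
  have "k (Sup (fst ` P)) = k (Sup (snd ` P))" if P: "P \<subseteq> {(a, b). k a = k b}" for P
  proof -
    have "k ` fst ` P = k ` snd ` P" unfolding image_image using P by (auto intro!: image_cong)
    then show ?thesis using assms by (simp add: frame_hom_def)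
  qed
  then show ?thesis
    using assms unfolding frame_congruence_def frame_hom_def
    by (auto simp: equiv_def refl_on_def sym_def trans_def)
qed

theorem equaliser_universal:
  fixes e :: "'x::frame \<Rightarrow> 'e::frame" and f g :: "'y::frame \<Rightarrow> 'x" and k :: "'x \<Rightarrow> 'z::frame"
  assumes e: "is_equaliser e f g"
  shows "e \<circ> f = e \<circ> g"
    and "frame_hom k \<Longrightarrow> k \<circ> f = k \<circ> g \<Longrightarrow> \<exists>!h. frame_hom h \<and> h \<circ> e = k"
proof -
  have hom: "frame_hom e" and surj: "surj e"
    and ker: "{(a, b). e a = e b} = generated_congruence (range (\<lambda>V. (f V, g V)))"
    using e by (auto simp: is_equaliser_def is_sublocale_def)
  have "range (\<lambda>V. (f V, g V)) \<subseteq> generated_congruence (range (\<lambda>V. (f V, g V)))"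
    unfolding generated_congruence_def by blast
  then show "e \<circ> f = e \<circ> g" unfolding ker[symmetric] by (simp add: fun_eq_iff image_subset_iff)
  assume k: "frame_hom k" and eq: "k \<circ> f = k \<circ> g"
  have "generated_congruence (range (\<lambda>V. (f V, g V))) \<subseteq> {(a, b). k a = k b}"
    unfolding generated_congruence_def
    using frame_congruence_kernel[OF k] eq by (intro Inter_lower) (auto simp: fun_eq_iff)
  then have le: "k a = k b" if "e a = e b" for a b
    using that unfolding ker[symmetric] by blast
  define h where "h = k \<circ> inv e"
  have he: "h (e a) = k a" for a
    unfolding h_def using le[OF surj_f_inv_f[OF surj]] by simp
  have "frame_hom h"
    unfolding frame_hom_def
  proof (intro conjI allI)
    show "h top = top" using he[of top] hom k by (simp add: frame_hom_def)
    show "h (inf x y) = inf (h x) (h y)" for x y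
    proof -
      obtain a b where "x = e a" "y = e b" using surj by (metis surjD)
      moreover have "h (inf (e a) (e b)) = inf (k a) (k b)"
        using he[of "inf a b"] hom k by (simp add: frame_hom_def)
      ultimately show ?thesis by (simp add: he)
    qed
    show "h (Sup A) = Sup (h ` A)" for A
    proof -
      obtain B where B: "A = e ` B" using surj by (metis subset_UNIV subset_imageE)
      then have "h ` A = k ` B" by (simp add: image_image he)
      then show ?thesis using he[of "Sup B"] hom k by (simp add: B frame_hom_def)
    qed
  qed
  moreover have "h \<circ> e = k" by (simp add: fun_eq_iff he)
  ultimately show "\<exists>!h. frame_hom h \<and> h \<circ> e = k"
    using surj by (metis surj_fun_eq)
qed

theorem kernel_pair_universal:
  fixes q :: "'q::frame \<Rightarrow> 'x::frame" and r :: "('x, 'x) tensor \<Rightarrow> 'r::frame"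
    and f g :: "'x \<Rightarrow> 'z::frame"
  assumes r: "is_kernel_pair q r"
  shows "source r \<circ> q = target r \<circ> q"
    and "frame_hom f \<Longrightarrow> frame_hom g \<Longrightarrow> f \<circ> q = g \<circ> q \<Longrightarrow>
           \<exists>!h. frame_hom h \<and> h \<circ> source r = f \<and> h \<circ> target r = g"
proof -
  note eq = r[unfolded is_kernel_pair_def]
  show "source r \<circ> q = target r \<circ> q"
    using equaliser_universal(1)[OF eq] by (simp add: source_def target_def comp_assoc)
  assume f: "frame_hom f" and g: "frame_hom g" and fg: "f \<circ> q = g \<circ> q"
  obtain k :: "('x, 'x) tensor \<Rightarrow> 'z"
    where k: "frame_hom k" "k \<circ> iota1 = f" "k \<circ> iota2 = g"
      and uniq: "\<And>k'. frame_hom k' \<Longrightarrow> k' \<circ> iota1 = f \<Longrightarrow> k' \<circ> iota2 = g \<Longrightarrow> k' = k"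
    using tensor_universal[OF f g] by blast
  have hom: "frame_hom r" using eq by (simp add: is_equaliser_def is_sublocale_def)
  have "k \<circ> (iota1 \<circ> q) = k \<circ> (iota2 \<circ> q)" using k fg by (simp add: comp_assoc[symmetric])
  then have ex1: "\<exists>!h. frame_hom h \<and> h \<circ> r = k" by (rule equaliser_universal(2)[OF eq k(1)])
  have "h \<circ> source r = f \<and> h \<circ> target r = g \<longleftrightarrow> h \<circ> r = k" if "frame_hom h" for h
    using uniq[OF frame_hom_comp[OF that hom]] k by (auto simp: source_def target_def comp_assoc)
  then show "\<exists>!h. frame_hom h \<and> h \<circ> source r = f \<and> h \<circ> target r = g" using ex1 by metis
qed

section \<open>The relation induced by a pair of cones\<close>

definition cone_rel ::
    "('x::frame \<Rightarrow> 'x) \<Rightarrow> ('x \<Rightarrow> 'x) \<Rightarrow> ('x, 'x) tensor \<Rightarrow> ('x, 'x) tensor \<Rightarrow> bool" where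
  "cone_rel u d p p' \<longleftrightarrow> (\<exists>a b c e. p = rect a b \<and> p' = rect c e \<and>
     inf (u a) b = inf (u c) e \<and> inf a (d b) = inf c (d e))"

definition saturated :: "('a::frame \<Rightarrow> 'a \<Rightarrow> bool) \<Rightarrow> 'a \<Rightarrow> bool" where
  "saturated S z \<longleftrightarrow> (\<forall>p p' w. S p p' \<longrightarrow> (inf p w \<le> z \<longleftrightarrow> inf p' w \<le> z))"

definition saturation :: "('a::frame \<Rightarrow> 'a \<Rightarrow> bool) \<Rightarrow> 'a \<Rightarrow> 'a" where
  "saturation S z = Inf {v. saturated S v \<and> z \<le> v}"

lemma saturation_least:
  "saturated S (saturation S z)" "z \<le> saturation S z"
  "saturated S v \<Longrightarrow> z \<le> v \<Longrightarrow> saturation S z \<le> v"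
  unfolding saturation_def by (auto simp: saturated_def le_Inf_iff intro: Inf_lower Inf_greatest)

text \<open>The sublocale \<open>R\<^sub>u\<^sub>,\<^sub>d\<close> has as its frame a set of elements of the tensor product, ordered as there.
  That set depends on \<open>u\<close> and \<open>d\<close> and cannot be made into a type, so it is kept as a carrier.\<close>

definition induced_opens :: "('x::frame \<Rightarrow> 'x) \<Rightarrow> ('x \<Rightarrow> 'x) \<Rightarrow> ('x, 'x) tensor set" where
  "induced_opens u d = {z. saturated (cone_rel u d) z}"

definition induced_map ::
    "('x::frame \<Rightarrow> 'x) \<Rightarrow> ('x \<Rightarrow> 'x) \<Rightarrow> ('x, 'x) tensor \<Rightarrow> ('x, 'x) tensor" where
  "induced_map u d = saturation (cone_rel u d)"

text \<open>Isomorphism of sublocales with carriers \<open>A\<close>, \<open>B\<close> and frame maps \<open>e\<close>, \<open>f\<close>: an isomorphism of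
  the frames (equivalently, of their orders) commuting with the frame maps.\<close>

definition sublocale_iso ::
    "'r::order set \<Rightarrow> ('a \<Rightarrow> 'r) \<Rightarrow> 's::order set \<Rightarrow> ('a \<Rightarrow> 's) \<Rightarrow> bool" where
  "sublocale_iso A e B f \<longleftrightarrow> (\<exists>\<phi>. bij_betw \<phi> A B \<and>
     (\<forall>x\<in>A. \<forall>y\<in>A. x \<le> y \<longleftrightarrow> \<phi> x \<le> \<phi> y) \<and> (\<forall>z. \<phi> (e z) = f z))"

end

theory Submission
  imports Defs
begin

text \<open>Let \<open>g\<close> be the direct image of \<open>q\<close>. The join-preserving map on \<open>\<O>X \<otimes> \<O>X\<close> with
  \<open>a \<otimes> b \<mapsto> b \<sqinter> q (g a)\<close> respects the congruence defining \<open>R\<close> by Frobenius reciprocity, and the map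
  it induces on \<open>\<O>R\<close> is the direct image of the target map (Beck--Chevalley). Hence both cones of \<open>R\<close>
  are the closure \<open>c = q \<circ> g\<close>. In \<open>\<O>R\<close> the rectangle \<open>a \<otimes> b\<close> agrees with
  \<open>(a \<sqinter> c b) \<otimes> (c a \<sqinter> b)\<close>, so \<open>\<sim>\<close> is contained in the congruence of \<open>R\<close>; conversely \<open>\<sim>\<close> relates
  \<open>q V \<otimes> \<top>\<close> to \<open>\<top> \<otimes> q V\<close>, because \<open>c (q V) = c \<top> \<sqinter> q V\<close>. So both sublocales are quotients by
  the same congruence.\<close>

section \<open>Frame congruences\<close>

lemma generated_congruence_subset:
  "frame_congruence E \<Longrightarrow> P \<subseteq> E \<Longrightarrow> generated_congruence P \<subseteq> E"
  unfolding generated_congruence_def by blast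

lemma subset_generated_congruence: "P \<subseteq> generated_congruence P"
  unfolding generated_congruence_def by blast

text \<open>Congruences are symmetric, so those containing \<open>P\<close> are those containing its
  converse. This lets the two coproduct injections trade places in the kernel of
  \<open>r\<close>.\<close>

lemma generated_congruence_converse: "generated_congruence (P\<inverse>) = generated_congruence P"
proof -
  have "P\<inverse> \<subseteq> E \<longleftrightarrow> P \<subseteq> E" if "frame_congruence E" for E
  proof -
    have "sym E" using that by (simp add: frame_congruence_def equiv_def)
    then show ?thesis by (auto dest: symD)
  qed
  then have "{E. frame_congruence E \<and> P\<inverse> \<subseteq> E} = {E. frame_congruence E \<and> P \<subseteq> E}" by auto
  then show ?thesis unfolding generated_congruence_def by simp
qed

text \<open>Testing against every \<open>w\<close> yields closure under meets, since a factor
  \<open>c\<close> can be absorbed into the test. Joins follow from distributivity, as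
  \<open>G\<close> computes \<open>F\<close> at a join from its values on the members. This form
  covers both join-preserving maps and the predicate of lying below a fixed element.\<close>

lemma frame_congruence_meet_stable:
  fixes F :: "'a::frame \<Rightarrow> 'b"
  assumes "\<And>A. F (Sup A) = G (F ` A)"
  shows "frame_congruence {(x, y). \<forall>w. F (inf x w) = F (inf y w)}" (is "frame_congruence ?E")
  unfolding frame_congruence_def
proof (intro conjI allI impI)
  show "equiv UNIV ?E"
    by (auto simp: equiv_def refl_on_def sym_def trans_def)
next
  fix a b c d assume "(a, b) \<in> ?E \<and> (c, d) \<in> ?E"
  then have ab: "F (inf a w) = F (inf b w)" and cd: "F (inf c w) = F (inf d w)" for w
    by auto
  have "F (inf (inf a c) w) = F (inf (inf b d) w)" for w
    using ab[of "inf c w"] cd[of "inf b w"] by (simp add: ac_simps)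
  then show "(inf a c, inf b d) \<in> ?E" by simp
next
  fix P assume P: "P \<subseteq> ?E"
  have "F (inf (Sup (fst ` P)) w) = F (inf (Sup (snd ` P)) w)" for w
  proof -
    have "(\<lambda>p. F (inf (fst p) w)) ` P = (\<lambda>p. F (inf (snd p) w)) ` P"
      using P by (intro image_cong) auto
    then show ?thesis by (simp add: Sup_inf_frame assms image_image)
  qed
  then show "(Sup (fst ` P), Sup (snd ` P)) \<in> ?E" by simp
qed

section \<open>Quotients and saturated elements\<close>

lemma frame_hom_le_inf: "frame_hom r \<Longrightarrow> r x \<le> r y \<longleftrightarrow> r (inf x y) = r x"
  by (simp add: frame_hom_def inf.absorb_iff1)

lemma left_adjoint_Sup': "left_adjoint_of g f \<Longrightarrow> g (Sup A) = Sup (g ` A)"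
  for g :: "'b::complete_lattice \<Rightarrow> 'a::complete_lattice"
  by (rule left_adjoint_Sup[of g f]) (simp add: left_adjoint_of_def)

text \<open>The right-hand side says that \<open>z\<close> is fixed by the nucleus of
  \<open>r\<close>. By \<open>complete\<close>, a saturated \<open>z\<close> cannot separate the
  generators \<open>P\<close>, hence it cannot separate any pair in the congruence they generate,
  the kernel of \<open>r\<close>. The converse rests on \<open>sound\<close>.\<close>

lemma saturated_iff_closed:
  fixes r :: "'a::frame \<Rightarrow> 'r::frame"
  assumes r: "frame_hom r"
    and ker: "{(a, b). r a = r b} = generated_congruence P"
    and sound: "\<And>p p'. S p p' \<Longrightarrow> r p = r p'"
    and complete: "\<And>a b. (a, b) \<in> P \<Longrightarrow> S a b"
  shows "saturated S z \<longleftrightarrow> (\<forall>w. r w \<le> r z \<longrightarrow> w \<le> z)"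
proof
  assume z: "saturated S z"
  let ?E = "{(x, y). \<forall>w. (inf x w \<le> z) = (inf y w \<le> z)}"
  have "frame_congruence ?E"
    by (rule frame_congruence_meet_stable[where G = "\<lambda>B. \<forall>b\<in>B. b"]) (auto simp: Sup_le_iff)
  moreover have "P \<subseteq> ?E" using z complete by (auto simp: saturated_def)
  ultimately have sub: "{(a, b). r a = r b} \<subseteq> ?E"
    unfolding ker by (rule generated_congruence_subset)
  show "\<forall>w. r w \<le> r z \<longrightarrow> w \<le> z"
  proof (intro allI impI)
    fix w assume "r w \<le> r z"
    then have "r (inf w z) = r w" by (simp add: frame_hom_le_inf[OF r])
    then have "(inf w z, w) \<in> ?E" using sub by blast
    then have "inf (inf w z) top \<le> z \<longleftrightarrow> inf w top \<le> z" by blast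
    then show "w \<le> z" by simp
  qed
next
  assume closed: "\<forall>w. r w \<le> r z \<longrightarrow> w \<le> z"
  then have iff: "w \<le> z \<longleftrightarrow> r w \<le> r z" for w by (blast intro: frame_hom_mono[OF r])
  show "saturated S z"
    unfolding saturated_def iff using sound r by (auto simp: frame_hom_def)
qed

text \<open>A quotient frame is isomorphic to the fixed elements of its nucleus. By
  \<open>saturated_iff_closed\<close> these are the saturated elements, so the nucleus is the
  saturation.\<close>

lemma sublocale_iso_saturated:
  fixes r :: "'a::frame \<Rightarrow> 'r::frame"
  assumes r: "is_sublocale r"
    and ker: "{(a, b). r a = r b} = generated_congruence P"
    and sound: "\<And>p p'. S p p' \<Longrightarrow> r p = r p'"
    and complete: "\<And>a b. (a, b) \<in> P \<Longrightarrow> S a b"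
  shows "sublocale_iso UNIV r {z. saturated S z} (saturation S)"
proof -
  have hom: "frame_hom r" and surj: "surj r" using r by (auto simp: is_sublocale_def)
  have closed: "saturated S z \<longleftrightarrow> (\<forall>w. r w \<le> r z \<longrightarrow> w \<le> z)" for z
    using hom ker sound complete by (rule saturated_iff_closed)
  \<comment> \<open>This is the right adjoint of \<open>r\<close>; it is a section because
    \<open>r\<close> is surjective.\<close>
  define \<rho> where "\<rho> x = Sup {w. r w \<le> x}" for x
  have r_\<rho>: "r (\<rho> x) = x" for x
  proof (rule order.antisym)
    show "r (\<rho> x) \<le> x" using hom by (auto simp: \<rho>_def frame_hom_def intro!: SUP_least)
    obtain w where "x = r w" using surj by blast
    then show "x \<le> r (\<rho> x)" by (auto simp: \<rho>_def intro!: frame_hom_mono[OF hom] Sup_upper)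
  qed
  have le_\<rho>: "w \<le> \<rho> x" if "r w \<le> x" for w x
    using that by (simp add: \<rho>_def Sup_upper)
  have sat: "saturated S (\<rho> x)" for x by (auto simp: closed r_\<rho> intro: le_\<rho>)
  have \<rho>_r: "\<rho> (r z) = z" if "saturated S z" for z
    using that by (auto simp: closed r_\<rho> le_\<rho> intro: order.antisym)
  have "bij_betw \<rho> UNIV {z. saturated S z}"
    by (rule bij_betw_byWitness[where f' = r]) (auto simp: r_\<rho> \<rho>_r sat)
  moreover have "x \<le> y \<longleftrightarrow> \<rho> x \<le> \<rho> y" for x y
    using le_\<rho>[of "\<rho> x" y] frame_hom_mono[OF hom, of "\<rho> x" "\<rho> y"] by (auto simp: r_\<rho>)
  moreover have "\<rho> (r z) = saturation S z" for z
  proof (rule order.antisym)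
    have "r z \<le> r (saturation S z)" by (rule frame_hom_mono[OF hom saturation_least(2)])
    then show "\<rho> (r z) \<le> saturation S z"
      using saturation_least(1)[of S z] by (simp add: closed r_\<rho>)
    show "saturation S z \<le> \<rho> (r z)" by (rule saturation_least(3)[OF sat le_\<rho>]) simp
  qed
  ultimately show ?thesis unfolding sublocale_iso_def by blast
qed

section \<open>Direct images along quotients\<close>

text \<open>The extension has a right adjoint, sending \<open>V\<close> to the C-ideal of all
  \<open>(a, b)\<close> with \<open>\<phi> a b \<le> V\<close>, and therefore preserves joins.
  Unlike in \<open>tensor_universal\<close>, meets need not be preserved, as direct images in
  general do not preserve them.\<close>

lemma tensor_bilinear_extension:
  fixes \<phi> :: "'a::frame \<Rightarrow> 'b::frame \<Rightarrow> 'c::complete_lattice"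
  assumes Sup1: "\<And>A b. \<phi> (Sup A) b = (SUP a\<in>A. \<phi> a b)"
    and Sup2: "\<And>a B. \<phi> a (Sup B) = (SUP b\<in>B. \<phi> a b)"
  obtains T :: "('a, 'b) tensor \<Rightarrow> 'c"
  where "\<And>A. T (Sup A) = Sup (T ` A)" and "\<And>a b. T (rect a b) = \<phi> a b"
proof
  define T where "T D = (SUP (a, b) \<in> rep_tensor D. \<phi> a b)" for D :: "('a, 'b) tensor"
  have mono1: "\<phi> a' b \<le> \<phi> a b" if "a' \<le> a" for a a' b
    using Sup1[of "{a', a}" b] that by (simp add: sup.absorb2 le_iff_sup)
  have mono2: "\<phi> a b' \<le> \<phi> a b" if "b' \<le> b" for a b b'
    using Sup2[of a "{b', b}"] that by (simp add: sup.absorb2 le_iff_sup)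
  have mono: "\<phi> a' b' \<le> \<phi> a b" if "a' \<le> a" "b' \<le> b" for a a' b b'
    using mono1[OF that(1)] mono2[OF that(2)] by (rule order_trans)
  show "T (Sup A) = Sup (T ` A)" for A
  proof (rule left_adjoint_Sup)
    fix U :: "('a, 'b) tensor" and V :: 'c
    let ?G = "{(a, b). \<phi> a b \<le> V}"
    have "c_ideal ?G"
      by (rule c_idealI) (auto simp: Sup1 Sup2 intro: SUP_least order_trans[OF mono])
    then have "rep_tensor (abs_tensor ?G) = ?G" by (simp add: abs_tensor_inverse)
    then show "T U \<le> V \<longleftrightarrow> U \<le> abs_tensor ?G"
      unfolding T_def less_eq_tensor_def SUP_le_iff by auto
  qed
  \<comment> \<open>A rectangle, as a C-ideal, also contains all pairs with a bottom coordinate;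
    these contribute only \<open>bot\<close> to the join.\<close>
  have "\<phi> bot b = bot" "\<phi> a bot = bot" for a b
    using Sup1[of "{}" b] Sup2[of a "{}"] by simp_all
  then show "T (rect a b) = \<phi> a b" for a b
    unfolding T_def rep_rect
    by (intro order.antisym SUP_least SUP_upper2[of "(a, b)"]) (auto intro: mono)
qed

text \<open>The coproduct injections are abstracted to \<open>f\<^sub>1\<close> and \<open>f\<^sub>2\<close> so that the lemma applies to the
  target map and, with the two exchanged, to the source map.\<close>

lemma open_map_quotient:
  fixes q :: "'q::frame \<Rightarrow> 'x::frame" and f\<^sub>1 f\<^sub>2 :: "'x \<Rightarrow> 'w::frame" and r :: "'w \<Rightarrow> 'r::frame"
  assumes q: "frame_hom q" and adj: "left_adjoint_of g q"
    and frob: "\<And>U V. g (inf U (q V)) = inf (g U) V"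
    and f1: "frame_hom f\<^sub>1" and f2: "frame_hom f\<^sub>2"
    and gen: "\<And>w. \<exists>C. w = (SUP (a, b) \<in> C. inf (f\<^sub>1 a) (f\<^sub>2 b))"
    and r: "is_sublocale r"
    and ker: "{(a, b). r a = r b} = generated_congruence (range (\<lambda>V. (f\<^sub>1 (q V), f\<^sub>2 (q V))))"
    and T_Sup: "\<And>A. T (Sup A) = Sup (T ` A)"
    and T_rect: "\<And>a b. T (inf (f\<^sub>1 a) (f\<^sub>2 b)) = inf b (q (g a))"
  shows "open_map (r \<circ> f\<^sub>2)" and "lower (r \<circ> f\<^sub>2) (r (f\<^sub>1 a)) = q (g a)"
proof -
  have hom: "frame_hom r" and surj: "surj r" using r by (auto simp: is_sublocale_def)
  have unit: "U \<le> q (g U)" for U using adj by (auto simp: left_adjoint_of_def)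
  \<comment> \<open>As \<open>T\<close> preserves joins and rectangles generate, it suffices to take
    a rectangle for \<open>w\<close>; the premise compares the values that \<open>T_rect\<close>
    gives there.\<close>
  have T_ext: "T (inf (inf (f\<^sub>1 a) (f\<^sub>2 b)) w) = T (inf (inf (f\<^sub>1 a') (f\<^sub>2 b')) w)"
    if "\<And>x y. inf (inf y b) (q (g (inf x a))) = inf (inf y b') (q (g (inf x a')))" for a b a' b' w
  proof -
    obtain C where w: "w = (SUP (x, y) \<in> C. inf (f\<^sub>1 x) (f\<^sub>2 y))" using gen by blast
    have *: "inf (inf (f\<^sub>1 a) (f\<^sub>2 b)) (inf (f\<^sub>1 x) (f\<^sub>2 y)) = inf (f\<^sub>1 (inf x a)) (f\<^sub>2 (inf y b))"
      for a b x y using f1 f2 by (simp add: frame_hom_def ac_simps)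
    show ?thesis
      unfolding w inf_Sup_frame T_Sup image_image by (simp add: case_prod_unfold * T_rect that)
  qed
  let ?E = "{(x, y). \<forall>w. T (inf x w) = T (inf y w)}"
  have tops: "f\<^sub>1 top = top" "f\<^sub>2 top = top" using f1 f2 by (auto simp: frame_hom_def)
  have q_inf: "q (inf x y) = inf (q x) (q y)" for x y using q by (simp add: frame_hom_def)
  \<comment> \<open>By Frobenius reciprocity for \<open>g\<close>, after meeting with a rectangle of
    sides \<open>x\<close> and \<open>y\<close> both arguments are sent to
    \<open>y \<sqinter> q (g x) \<sqinter> q V\<close>.\<close>
  have "T (inf (f\<^sub>1 (q V)) w) = T (inf (f\<^sub>2 (q V)) w)" for V w
    using T_ext[of top "q V" "q V" top w] by (simp add: tops frob q_inf ac_simps)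
  then have "range (\<lambda>V. (f\<^sub>1 (q V), f\<^sub>2 (q V))) \<subseteq> ?E" by auto
  then have sub: "{(a, b). r a = r b} \<subseteq> ?E"
    unfolding ker
    by (intro generated_congruence_subset frame_congruence_meet_stable[where G = Sup] T_Sup)
  have T_eq: "T x = T y" if "r x = r y" for x y
  proof -
    have "(x, y) \<in> ?E" using sub that by blast
    then have "T (inf x top) = T (inf y top)" by blast
    then show ?thesis by simp
  qed
  have T_mono: "T x \<le> T y" if "x \<le> y" for x y
    using T_Sup[of "{x, y}"] that by (simp add: sup.absorb2 le_iff_sup)
  have T_mono_r: "T x \<le> T y" if "r x \<le> r y" for x y
    using T_eq[of "inf x y" x] T_mono[of "inf x y" y] that by (simp add: frame_hom_le_inf[OF hom])
  \<comment> \<open>\<open>T\<close> is constant on the fibres of \<open>r\<close> by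
    \<open>T_eq\<close>, so the choice of preimage does not matter and \<open>t\<close> is the map
    induced on the quotient.\<close>
  define t where "t = T \<circ> inv r"
  have t: "t (r w) = T w" for w
    unfolding t_def comp_def by (rule T_eq) (rule surj_f_inv_f[OF surj])
  have qr: "r (f\<^sub>1 (q V)) = r (f\<^sub>2 (q V))" for V
    using subset_generated_congruence[of "range (\<lambda>V. (f\<^sub>1 (q V), f\<^sub>2 (q V)))"]
    unfolding ker[symmetric] by auto
  have adjoint: "T w \<le> V \<longleftrightarrow> r w \<le> r (f\<^sub>2 V)" for w V
  proof
    assume TV: "T w \<le> V"
    obtain C where w: "w = (SUP (a, b) \<in> C. inf (f\<^sub>1 a) (f\<^sub>2 b))" using gen by blast
    have "r (inf (f\<^sub>1 a) (f\<^sub>2 b)) \<le> r (f\<^sub>2 V)" if "(a, b) \<in> C" for a b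
    proof -
      have "inf (f\<^sub>1 a) (f\<^sub>2 b) \<le> w" unfolding w by (rule SUP_upper2[OF that]) simp
      then have le: "inf b (q (g a)) \<le> V" using T_mono T_rect TV order_trans by metis
      \<comment> \<open>The unit enlarges \<open>a\<close> to \<open>q (g a)\<close>, which can then
        cross to the second coordinate because \<open>r\<close> identifies the two copies of
        \<open>q V\<close>.\<close>
      have "r (inf (f\<^sub>1 a) (f\<^sub>2 b)) \<le> r (inf (f\<^sub>1 (q (g a))) (f\<^sub>2 b))"
        by (intro frame_hom_mono[OF hom] inf_mono frame_hom_mono[OF f1] unit order.refl)
      also have "\<dots> = r (f\<^sub>2 (inf b (q (g a))))"
        using hom f2 qr by (simp add: frame_hom_def inf_commute)
      also have "\<dots> \<le> r (f\<^sub>2 V)" by (intro frame_hom_mono[OF hom] frame_hom_mono[OF f2] le)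
      finally show ?thesis .
    qed
    moreover have "r w = Sup (r ` (\<lambda>(a, b). inf (f\<^sub>1 a) (f\<^sub>2 b)) ` C)"
      using hom unfolding w frame_hom_def by blast
    ultimately show "r w \<le> r (f\<^sub>2 V)" by (auto intro!: SUP_least)
  next
    assume "r w \<le> r (f\<^sub>2 V)"
    then have "T w \<le> T (f\<^sub>2 V)" by (rule T_mono_r)
    also have "\<dots> \<le> V" using T_rect[of top V] by (simp add: tops)
    finally show "T w \<le> V" .
  qed
  have left: "left_adjoint_of t (r \<circ> f\<^sub>2)"
    unfolding left_adjoint_of_def
  proof (intro allI)
    fix U V
    obtain w where "U = r w" using surj by blast
    then show "t U \<le> V \<longleftrightarrow> U \<le> (r \<circ> f\<^sub>2) V" by (simp add: t adjoint)
  qed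
  have "t (inf U ((r \<circ> f\<^sub>2) V)) = inf (t U) V" for U V
  proof -
    obtain w where U: "U = r w" using surj by blast
    obtain C where w: "w = (SUP (a, b) \<in> C. inf (f\<^sub>1 a) (f\<^sub>2 b))" using gen by blast
    \<comment> \<open>Meeting a rectangle with \<open>f\<^sub>2 V\<close> only shrinks its second
      side to \<open>inf b V\<close>, and by \<open>T_rect\<close> the value of \<open>T\<close>
      shrinks by the factor \<open>V\<close>.\<close>
    have *: "T (inf (inf (f\<^sub>1 a) (f\<^sub>2 b)) (f\<^sub>2 V)) = inf (T (inf (f\<^sub>1 a) (f\<^sub>2 b))) V" for a b
      using f2 T_rect[of a "inf b V"] by (simp add: frame_hom_def T_rect ac_simps)
    have "t (inf U ((r \<circ> f\<^sub>2) V)) = T (inf w (f\<^sub>2 V))"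
      using hom t[of "inf w (f\<^sub>2 V)"] by (simp add: U frame_hom_def)
    also have "\<dots> = inf (T w) V"
      unfolding w Sup_inf_frame T_Sup image_image by (simp add: case_prod_unfold *)
    finally show ?thesis by (simp add: U t)
  qed
  then show "open_map (r \<circ> f\<^sub>2)"
    unfolding open_map_def using left frame_hom_comp[OF hom f2] by blast
  show "lower (r \<circ> f\<^sub>2) (r (f\<^sub>1 a)) = q (g a)"
    using T_rect[of a top] by (simp add: lower_eqI[OF left] t tops)
qed

section \<open>Cones of the kernel pair and the relation they induce\<close>

lemma kernel_pair_cones:
  fixes q :: "'q::frame \<Rightarrow> 'x::frame" and r :: "('x, 'x) tensor \<Rightarrow> 'r::frame"
  assumes q: "frame_hom q" and adj: "left_adjoint_of g q"
    and frob: "\<And>U V. g (inf U (q V)) = inf (g U) V"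
    and r: "is_kernel_pair q r"
  shows "has_open_cones r" and "up_cone r = q \<circ> g" and "down_cone r = q \<circ> g"
proof -
  have sub: "is_sublocale r"
    and ker: "{(a, b). r a = r b}
      = generated_congruence (range (\<lambda>V. (iota1 (q V), iota2 (q V))))"
    using r by (auto simp: is_kernel_pair_def is_equaliser_def)
  have "range (\<lambda>V. (iota2 (q V) :: ('x, 'x) tensor, iota1 (q V) :: ('x, 'x) tensor))
      = (range (\<lambda>V. (iota1 (q V), iota2 (q V))))\<inverse>"
    by auto
  then have ker': "{(a, b). r a = r b}
      = generated_congruence (range (\<lambda>V. (iota2 (q V), iota1 (q V))))"
    by (simp only: ker generated_congruence_converse)
  have gen: "\<exists>C. w = (SUP (a, b) \<in> C. inf (iota1 a) (iota2 b))" for w :: "('x, 'x) tensor"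
    using tensor_eq_Sup_rect[of w] unfolding rect_def by blast
  have gen': "\<exists>C. w = (SUP (b, a) \<in> C. inf (iota2 b) (iota1 a))" for w :: "('x, 'x) tensor"
  proof -
    obtain C where "w = (SUP (a, b) \<in> C. inf (iota1 a) (iota2 b))" using gen by blast
    then have "w = (SUP (b, a) \<in> prod.swap ` C. inf (iota2 b) (iota1 a))"
      by (simp add: image_image case_prod_unfold inf_commute)
    then show ?thesis by blast
  qed
  have c_Sup: "q (g (Sup A)) = (SUP a\<in>A. q (g a))" for A
    using q by (simp add: left_adjoint_Sup'[OF adj] frame_hom_def image_image)
  \<comment> \<open>\<open>T\<close> descends to the direct image of the target map, and its mirror
    image \<open>T'\<close> to that of the source map.\<close>
  obtain T :: "('x, 'x) tensor \<Rightarrow> 'x"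
    where T: "\<And>A. T (Sup A) = Sup (T ` A)" "\<And>a b. T (rect a b) = inf b (q (g a))"
    by (rule tensor_bilinear_extension[of "\<lambda>a b. inf b (q (g a))"])
      (auto simp: c_Sup inf_Sup_frame Sup_inf_frame image_image)
  obtain T' :: "('x, 'x) tensor \<Rightarrow> 'x"
    where T': "\<And>A. T' (Sup A) = Sup (T' ` A)" "\<And>a b. T' (rect a b) = inf a (q (g b))"
    by (rule tensor_bilinear_extension[of "\<lambda>a b. inf a (q (g b))"])
      (auto simp: c_Sup inf_Sup_frame Sup_inf_frame image_image)
  have T'_rect: "T' (inf (iota2 b) (iota1 a)) = inf a (q (g b))" for a b
    using T'(2) by (simp add: rect_def inf_commute)
  note target = open_map_quotient[OF q adj frob frame_hom_iota1 frame_hom_iota2 gen sub ker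
      T(1) T(2)[unfolded rect_def]]
  note source = open_map_quotient[OF q adj frob frame_hom_iota2 frame_hom_iota1 gen' sub ker'
      T'(1) T'_rect]
  show "has_open_cones r"
    using target(1) source(1) by (simp add: has_open_cones_def source_def target_def)
  show "up_cone r = q \<circ> g" "down_cone r = q \<circ> g"
    using target(2) source(2)
    by (simp_all add: fun_eq_iff up_cone_def down_cone_def source_def target_def)
qed

theorem proposition9p8:
  fixes q :: "'q::frame \<Rightarrow> 'x::frame"
    and r :: "('x, 'x) tensor \<Rightarrow> 'r::frame"
  assumes "open_map q"
    and "is_kernel_pair q r"
  shows "has_open_cones r \<and>
    sublocale_iso (UNIV :: 'r set) r
      (induced_opens (up_cone r) (down_cone r)) (induced_map (up_cone r) (down_cone r))"
proof -
  obtain g where q: "frame_hom q" and adj: "left_adjoint_of g q"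
    and frob: "\<And>U V. g (inf U (q V)) = inf (g U) V"
    using assms(1) by (auto simp: open_map_def)
  note cones = kernel_pair_cones[OF q adj frob assms(2)]
  have sub: "is_sublocale r"
    and ker: "{(a, b). r a = r b}
      = generated_congruence (range (\<lambda>V. (iota1 (q V), iota2 (q V))))"
    using assms(2) by (auto simp: is_kernel_pair_def is_equaliser_def)
  have hom: "frame_hom r" using sub by (simp add: is_sublocale_def)
  have r_inf: "r (inf x y) = inf (r x) (r y)" for x y using hom by (simp add: frame_hom_def)
  have i1_inf: "(iota1 (inf x y) :: ('x, 'x) tensor) = inf (iota1 x) (iota1 y)"
    and i2_inf: "(iota2 (inf x y) :: ('x, 'x) tensor) = inf (iota2 x) (iota2 y)" for x y :: 'x
    using frame_hom_iota1 frame_hom_iota2 by (auto simp: frame_hom_def)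
  have unit: "U \<le> q (g U)" for U using adj by (auto simp: left_adjoint_of_def)
  have qr: "r (iota1 (q V)) = r (iota2 (q V))" for V
    using kernel_pair_universal(1)[OF assms(2)] by (simp add: fun_eq_iff source_def target_def)
  have normal: "r (rect a b) = r (rect (inf a (q (g b))) (inf (q (g a)) b))" for a b
  proof -
    \<comment> \<open>The closures \<open>q (g a)\<close> and \<open>q (g b)\<close> may be moved
      between coordinates by \<open>qr\<close>; once next to \<open>a\<close> and \<open>b\<close>
      they are absorbed by the unit.\<close>
    have "r (iota1 a) \<le> r (iota1 (q (g a)))" "r (iota2 b) \<le> r (iota2 (q (g b)))"
      using unit by (auto intro!: frame_hom_mono[OF hom] frame_hom_mono[OF frame_hom_iota1]
          frame_hom_mono[OF frame_hom_iota2])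
    then show ?thesis
      unfolding rect_def i1_inf i2_inf r_inf qr
      by (intro order.antisym) (auto intro: le_infI1 le_infI2)
  qed
  \<comment> \<open>The sides of the rectangle on the right of \<open>normal\<close> are exactly the
    two elements that \<open>cone_rel\<close> requires to agree.\<close>
  have cone_sound: "r p = r p'" if "cone_rel (q \<circ> g) (q \<circ> g) p p'" for p p'
    using that normal unfolding cone_rel_def by (metis comp_apply)
  have closure: "q (g (q V)) = inf (q (g top)) (q V)" for V
    using frob[of top V] q by (simp add: frame_hom_def)
  have "cone_rel (q \<circ> g) (q \<circ> g) (iota1 (q V)) (iota2 (q V))" for V
  proof -
    have "iota1 (q V) = rect (q V) (top :: 'x)" "iota2 (q V) = rect (top :: 'x) (q V)"
      using frame_hom_iota1[where ?'a = 'x and ?'b = 'x]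
        frame_hom_iota2[where ?'a = 'x and ?'b = 'x]
      by (simp_all add: rect_def frame_hom_def)
    moreover have "inf ((q \<circ> g) (q V)) top = inf ((q \<circ> g) top) (q V)"
      "inf (q V) ((q \<circ> g) top) = inf top ((q \<circ> g) (q V))"
      by (simp_all add: closure inf_commute)
    ultimately show ?thesis unfolding cone_rel_def by blast
  qed
  then have "sublocale_iso UNIV r {z. saturated (cone_rel (q \<circ> g) (q \<circ> g)) z}
      (saturation (cone_rel (q \<circ> g) (q \<circ> g)))"
    by (intro sublocale_iso_saturated[OF sub ker] cone_sound) auto
  then show ?thesis using cones by (simp add: induced_opens_def induced_map_def)
qed

end
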